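(* Let $G$ be an analytic function and $c\in\mathbb{C}$, and assume there exists a function $P_0$ (analytic) such that $$G(F_1(A))=-\frac{1}{c-2\pi iA}+P_0(c-2\pi iA).$$ Let $y(A)$ be a solution of $$5\int_0^{y(A)}\frac{G(t)}{t\sqrt[6]{t^{-5}-11-t^5}}\,dt=A .$$ Then $$y(A)=F_1\Bigl(-\frac{w(e^{2\pi iA})}{2\pi i}+\frac{c}{2\pi i}\Bigr),$$ where $w(q)$ is a solution of the equation $$w(q)\exp\Bigl(C-\int_{c'}^{w(q)}P_0(t)\,dt\Bigr)=q$$ for suitable constants $C,c'$.
   Context: $F_1$ denotes the (local) inverse of $x\mapsto 5\int_0^x \frac{dt}{t\sqrt[6]{t^{-5}-11-t^5}}$, so $F_1'(A)=\frac15F_1(A)\sqrt[6]{F_1(A)^{-5}-11-F_1(A)^5}$. All identities are understood locally, on regions where the functions involved are analytic, $c-2\pi iA$ (in the first formula) and $G(y(A))$ are non-zero, with consistent local branches of inverses and of the sixth root; $w$ is an analytic function of $q=e^{2\pi iA}$ on the corresponding region. *)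

theory Defs
  imports "HOL-Complex_Analysis.Complex_Analysis"
begin

text \<open>
  An analytic branch \<open>s\<close> of the sixth root of \<open>1/t\<^sup>5 - 11 - t\<^sup>5\<close> on a region \<open>R\<close> that avoids the origin
  and the zeros of the radicand.
\<close>

definition sixth_root_branch :: "complex set \<Rightarrow> (complex \<Rightarrow> complex) \<Rightarrow> bool" where
  "sixth_root_branch R s \<longleftrightarrow>
     s holomorphic_on R \<and> (\<forall>t\<in>R. t \<noteq> 0 \<and> s t \<noteq> 0 \<and> s t ^ 6 = inverse (t ^ 5) - 11 - t ^ 5)"

text \<open>
  \<open>has_region_integral S f a b I\<close>: the integral of \<open>f\<close> from \<open>a\<close> to \<open>b\<close> along a path in \<open>S\<close> is \<open>I\<close>. It is
  only used for simply connected open \<open>S\<close> and \<open>f\<close> holomorphic on \<open>S\<close>, where \<open>I\<close> does not depend on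
  the path.
\<close>

definition has_region_integral ::
  "complex set \<Rightarrow> (complex \<Rightarrow> complex) \<Rightarrow> complex \<Rightarrow> complex \<Rightarrow> complex \<Rightarrow> bool" where
  "has_region_integral S f a b I \<longleftrightarrow>
     (\<exists>p. valid_path p \<and> path_image p \<subseteq> S \<and> pathstart p = a \<and> pathfinish p = b \<and>
          (f has_contour_integral I) p)"

text \<open>
  The origin is a singular boundary point of \<open>R\<close>. A fixed path \<open>\<gamma>\<close> leaving it into \<open>R\<close> determines how
  all integrals \<open>\<integral>\<^sub>0\<^sup>x\<close> start, so that they refer to one consistent branch. Contour integrals are
  gauge integrals over the parameter interval, hence the integral along \<open>\<gamma>\<close> is the
  (possibly improper) integral at the singular endpoint; its convergence is part of the predicate.
\<close>

definition path_from_origin :: "complex set \<Rightarrow> (real \<Rightarrow> complex) \<Rightarrow> bool" where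
  "path_from_origin R \<gamma> \<longleftrightarrow> valid_path \<gamma> \<and> pathstart \<gamma> = 0 \<and> \<gamma> ` {0<..1} \<subseteq> R"

definition has_integral_from_origin ::
  "complex set \<Rightarrow> (real \<Rightarrow> complex) \<Rightarrow> (complex \<Rightarrow> complex) \<Rightarrow> complex \<Rightarrow> complex \<Rightarrow> bool" where
  "has_integral_from_origin R \<gamma> f x I \<longleftrightarrow>
     (\<exists>J K. (f has_contour_integral J) \<gamma> \<and> has_region_integral R f (pathfinish \<gamma>) x K \<and> I = J + K)"

text \<open>
  \<open>F\<close> is a local inverse, defined and analytic on \<open>V\<close> with values in \<open>R\<close>, of
  \<open>x \<mapsto> 5 \<integral>\<^sub>0\<^sup>x dt / (t s(t))\<close>. This map is single-valued on \<open>R\<close>, so the identity below also makes it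
  a left inverse of \<open>F\<close> on the image of \<open>F\<close>.
\<close>

definition is_local_F1 ::
  "complex set \<Rightarrow> (complex \<Rightarrow> complex) \<Rightarrow> (real \<Rightarrow> complex) \<Rightarrow> complex set \<Rightarrow> (complex \<Rightarrow> complex) \<Rightarrow> bool"
  where
  "is_local_F1 R s \<gamma> V F \<longleftrightarrow>
     F holomorphic_on V \<and>
     (\<forall>A\<in>V. \<exists>I. has_integral_from_origin R \<gamma> (\<lambda>t. 1 / (t * s t)) (F A) I \<and> 5 * I = A)"

definition nome :: "complex \<Rightarrow> complex" where
  "nome A = exp (2 * of_real pi * \<i> * A)"

end

theory Submission
  imports Defs
begin

text \<open>
  Put \<open>u = \<Phi> \<circ> y\<close>, where \<open>\<Phi>\<close> is the elliptic-type integral that \<open>F1\<close> inverts, so that \<open>y = F1 \<circ> u\<close>.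
  Differentiating the integral equation for \<open>y\<close> gives \<open>G (F1 u) u' = 1\<close>. With \<open>W = c - 2\<pi>\<i> u\<close> this
  reads \<open>(1/W - P0 W) W' = 2\<pi>\<i>\<close>, so \<open>W exp (- \<integral> P0)\<close> and \<open>exp (2\<pi>\<i> A)\<close> have the same logarithmic
  derivative and agree up to a constant factor \<open>exp C\<close>.
\<close>

lemma has_region_integral_primitive:
  assumes "\<And>t. t \<in> S \<Longrightarrow> (g has_field_derivative f t) (at t)"
    and "has_region_integral S f a b I"
  shows "I = g b - g a"
proof -
  obtain p where p: "valid_path p" "path_image p \<subseteq> S" "pathstart p = a" "pathfinish p = b"
    "(f has_contour_integral I) p"
    using assms(2) unfolding has_region_integral_def by blast
  have "(f has_contour_integral (g (pathfinish p) - g (pathstart p))) p"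
    using assms(1) p(1,2) by (intro contour_integral_primitive[of S]) (auto intro: has_field_derivative_at_within)
  with p show ?thesis
    using has_contour_integral_unique by metis
qed

text \<open>Two points of an open connected set are joined inside it by a polynomial path, which is
  valid; the primitive then evaluates the integral along it.\<close>

lemma has_region_integral_exists:
  assumes "open S" "connected S" "a \<in> S" "b \<in> S"
    and "\<And>t. t \<in> S \<Longrightarrow> (g has_field_derivative f t) (at t)"
  shows "has_region_integral S f a b (g b - g a)"
proof -
  obtain p where p: "valid_path p" "path_image p \<subseteq> S" "pathstart p = a" "pathfinish p = b"
    using connected_open_polynomial_connected[OF assms(1-4)] valid_path_polynomial_function by metis
  have "(f has_contour_integral (g (pathfinish p) - g (pathstart p))) p"
    using assms(5) p(1,2) by (intro contour_integral_primitive[of S]) (auto intro: has_field_derivative_at_within)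
  with p show ?thesis
    unfolding has_region_integral_def by auto
qed

text \<open>The initial leg along \<open>\<gamma>\<close> contributes the same constant for every
  endpoint, so adding that constant to a suitably normalised primitive on the simply connected
  \<open>R\<close> gives the whole integral.\<close>

lemma has_integral_from_origin_primitive:
  assumes "open R" "simply_connected R" "f holomorphic_on R"
  obtains g where "\<And>t. t \<in> R \<Longrightarrow> (g has_field_derivative f t) (at t)"
    and "\<And>x I. has_integral_from_origin R \<gamma> f x I \<Longrightarrow> I = g x"
proof -
  obtain h where h: "\<And>t. t \<in> R \<Longrightarrow> (h has_field_derivative f t) (at t)"
    using assms simply_connected_eq_global_primitive by metis
  \<comment> \<open>If \<open>f\<close> has no integral along \<open>\<gamma>\<close>, the first
    summand is a mere default value; this is harmless, since then no \<open>I\<close> satisfies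
    \<open>has_integral_from_origin\<close>.\<close>
  let ?g = "\<lambda>x. contour_integral \<gamma> f + (h x - h (pathfinish \<gamma>))"
  have "I = ?g x" if "has_integral_from_origin R \<gamma> f x I" for x I
    using that has_region_integral_primitive[OF h] contour_integral_unique
    unfolding has_integral_from_origin_def by metis
  moreover have "(?g has_field_derivative f t) (at t)" if "t \<in> R" for t
    using h[OF that] by (auto intro!: derivative_eq_intros)
  ultimately show thesis using that by blast
qed

text \<open>Provides the function that recovers the argument of \<open>F\<close>: five times the
  shifted primitive of \<open>1 / (t * s t)\<close>.\<close>

lemma is_local_F1_left_inverse:
  assumes "open R" "simply_connected R" "sixth_root_branch R s" "is_local_F1 R s \<gamma> V F"
  obtains \<Phi> where "\<And>t. t \<in> R \<Longrightarrow> (\<Phi> has_field_derivative 5 / (t * s t)) (at t)"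
    and "\<And>A. A \<in> V \<Longrightarrow> \<Phi> (F A) = A"
proof -
  have "(\<lambda>t. 1 / (t * s t)) holomorphic_on R"
    using assms(3) unfolding sixth_root_branch_def by (auto intro!: holomorphic_intros)
  from has_integral_from_origin_primitive[OF assms(1,2) this]
  obtain g where g: "\<And>t. t \<in> R \<Longrightarrow> (g has_field_derivative 1 / (t * s t)) (at t)"
    "\<And>x I. has_integral_from_origin R \<gamma> (\<lambda>t. 1 / (t * s t)) x I \<Longrightarrow> I = g x"
    by blast
  show thesis
  proof
    show "((\<lambda>t. 5 * g t) has_field_derivative 5 / (t * s t)) (at t)" if "t \<in> R" for t
      using g(1)[OF that] by (auto intro!: derivative_eq_intros)
    show "5 * g (F A) = A" if "A \<in> V" for A
      using assms(4) that g(2) unfolding is_local_F1_def by metis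
  qed
qed

lemma has_integral_from_origin_endpoint:
  assumes "has_integral_from_origin R \<gamma> f x I"
  shows "x \<in> R"
  using assms unfolding has_integral_from_origin_def has_region_integral_def
  by (metis pathfinish_in_path_image subsetD)

text \<open>Multiplied by \<open>W\<close>, the equation says that the quotient of
  \<open>W exp (- Q W)\<close> and \<open>exp (\<alpha> A)\<close> has derivative zero; on the
  connected \<open>D\<close> this quotient is a constant, whose inverse is absorbed into
  \<open>exp C\<close>.\<close>

lemma separable_ode_solution:
  fixes D :: "complex set" and \<alpha> :: complex
  assumes "open D" "connected D"
    and W: "\<And>A. A \<in> D \<Longrightarrow> (W has_field_derivative W' A) (at A)"
    and nz: "\<And>A. A \<in> D \<Longrightarrow> W A \<noteq> 0"
    and Q: "\<And>A. A \<in> D \<Longrightarrow> (Q has_field_derivative P (W A)) (at (W A))"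
    and ode: "\<And>A. A \<in> D \<Longrightarrow> (1 / W A - P (W A)) * W' A = \<alpha>"
  obtains C where "\<And>A. A \<in> D \<Longrightarrow> W A * exp (C - Q (W A)) = exp (\<alpha> * A)"
proof (cases "D = {}")
  case False
  let ?E = "\<lambda>A. W A * exp (- Q (W A) - \<alpha> * A)"
  have "(?E has_field_derivative 0) (at A)" if "A \<in> D" for A
  proof -
    have "W' A - P (W A) * W' A * W A = \<alpha> * W A"
      using ode[OF that] nz[OF that] by (auto simp: field_simps)
    moreover have "((\<lambda>A. Q (W A)) has_field_derivative P (W A) * W' A) (at A)"
      by (rule DERIV_chain2[where f = Q and g = W, OF Q[OF that] W[OF that]])
    then have "(?E has_field_derivative
        (W' A - P (W A) * W' A * W A - \<alpha> * W A) * exp (- Q (W A) - \<alpha> * A)) (at A)"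
      by (auto intro!: derivative_eq_intros W that simp: algebra_simps)
    ultimately show ?thesis by simp
  qed
  then have "?E constant_on D"
    using assms(2,1) by (rule has_field_derivative_0_imp_constant_on)
  then obtain K where K: "\<And>A. A \<in> D \<Longrightarrow> ?E A = K"
    unfolding constant_on_def by blast
  \<comment> \<open>At any point of the nonempty \<open>D\<close>, \<open>K\<close> is a nonzero
    value of \<open>W\<close> times an exponential; hence \<open>inverse K\<close> has a
    logarithm.\<close>
  have "K \<noteq> 0"
    using False K nz by fastforce
  then obtain C where C: "exp C = inverse K"
    by (metis exp_Ln inverse_nonzero_iff_nonzero)
  have "W A * exp (C - Q (W A)) = exp (\<alpha> * A)" if "A \<in> D" for A
  proof -
    have "W A * exp (C - Q (W A)) = inverse K * ?E A * exp (\<alpha> * A)"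
      by (simp add: C exp_diff exp_minus field_simps)
    then show ?thesis using K[OF that] \<open>K \<noteq> 0\<close> by simp
  qed
  then show thesis using that by blast
qed (use that in blast)

theorem theorem6:
  fixes R V D :: "complex set"
    and s G P0 F1 y :: "complex \<Rightarrow> complex"
    and \<gamma> :: "real \<Rightarrow> complex"
    and c :: complex
  assumes "open R" "simply_connected R" "sixth_root_branch R s" "path_from_origin R \<gamma>"
    and "open V" "simply_connected V" "is_local_F1 R s \<gamma> V F1"
    and "G holomorphic_on R"
    and "P0 holomorphic_on (\<lambda>A. c - 2 * of_real pi * \<i> * A) ` V"
    and "\<And>A. A \<in> V \<Longrightarrow> c - 2 * of_real pi * \<i> * A \<noteq> 0"
    and "\<And>A. A \<in> V \<Longrightarrow>
           G (F1 A) = - (1 / (c - 2 * of_real pi * \<i> * A)) + P0 (c - 2 * of_real pi * \<i> * A)"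
    and "open D" "connected D" "y holomorphic_on D" "y ` D \<subseteq> F1 ` V"
    and "\<And>A. A \<in> D \<Longrightarrow> G (y A) \<noteq> 0"
    and "\<And>A. A \<in> D \<Longrightarrow>
           \<exists>I. has_integral_from_origin R \<gamma> (\<lambda>t. G t / (t * s t)) (y A) I \<and> 5 * I = A"
  shows "\<exists>C c'. \<forall>D'. open D' \<and> D' \<subseteq> D \<and> inj_on nome D' \<longrightarrow>
           (\<exists>w. w holomorphic_on nome ` D' \<and>
                w ` nome ` D' \<subseteq> (\<lambda>A. c - 2 * of_real pi * \<i> * A) ` V \<and>
                (\<forall>A\<in>D'. y A = F1 (- (w (nome A) / (2 * of_real pi * \<i>)) + c / (2 * of_real pi * \<i>))) \<and>
                (\<forall>q\<in>nome ` D'. \<exists>I.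
                   has_region_integral ((\<lambda>A. c - 2 * of_real pi * \<i> * A) ` V) P0 c' (w q) I \<and>
                   w q * exp (C - I) = q))"
proof -
  let ?L = "\<lambda>A. c - 2 * of_real pi * \<i> * A"
  obtain \<Phi> where \<Phi>: "\<And>t. t \<in> R \<Longrightarrow> (\<Phi> has_field_derivative 5 / (t * s t)) (at t)"
    and \<Phi>F: "\<And>A. A \<in> V \<Longrightarrow> \<Phi> (F1 A) = A"
    using is_local_F1_left_inverse[OF assms(1-3,7)] by metis
  have "(\<lambda>t. G t / (t * s t)) holomorphic_on R"
    using assms(3,8) unfolding sixth_root_branch_def by (auto intro!: holomorphic_intros)
  from has_integral_from_origin_primitive[OF assms(1,2) this]
  obtain H where H: "\<And>t. t \<in> R \<Longrightarrow> (H has_field_derivative G t / (t * s t)) (at t)"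
    and HI: "\<And>x I. has_integral_from_origin R \<gamma> (\<lambda>t. G t / (t * s t)) x I \<Longrightarrow> I = H x"
    by blast
  have yR: "y A \<in> R" if "A \<in> D" for A
    using assms(17)[OF that] has_integral_from_origin_endpoint by blast
  have Hy: "5 * H (y A) = A" if "A \<in> D" for A
    using assms(17)[OF that] HI by metis
  \<comment> \<open>Each \<open>y A\<close> is \<open>F1 v\<close> for some \<open>v\<close> in
    \<open>V\<close>, and \<open>\<Phi>\<close> returns this \<open>v\<close>. So \<open>u\<close>
    is a holomorphic choice of preimages under \<open>F1\<close>.\<close>
  define u where "u = \<Phi> \<circ> y"
  have u: "u A \<in> V" "F1 (u A) = y A" if "A \<in> D" for A
    using that assms(15) \<Phi>F unfolding u_def by force+
  have dy: "(y has_field_derivative deriv y A) (at A)" if "A \<in> D" for A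
    using assms(12,14) that holomorphic_derivI by blast
  define u' where "u' A = 5 / (y A * s (y A)) * deriv y A" for A
  have du: "(u has_field_derivative u' A) (at A)" if "A \<in> D" for A
    unfolding u_def u'_def comp_def
    by (rule DERIV_chain2[where f = \<Phi> and g = y, OF \<Phi>[OF yR[OF that]] dy[OF that]])
  \<comment> \<open>Differentiate \<open>5 * H (y A) = A\<close>, which holds throughout the open
    set \<open>D\<close>; the factor \<open>5 / (y s(y)) y'\<close> that appears is exactly
    \<open>u'\<close>.\<close>
  have Gu: "G (y A) * u' A = 1" if "A \<in> D" for A
  proof -
    have "((\<lambda>A. 5 * H (y A)) has_field_derivative 5 * (G (y A) / (y A * s (y A)) * deriv y A)) (at A)"
      by (intro DERIV_cmult DERIV_chain2[where f = H and g = y, OF H[OF yR[OF that]] dy[OF that]])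
    moreover have "((\<lambda>A. 5 * H (y A)) has_field_derivative 1) (at A)"
      by (rule has_field_derivative_transform_within_open[OF DERIV_ident assms(12) that]) (simp add: Hy)
    ultimately have "5 * (G (y A) / (y A * s (y A)) * deriv y A) = 1"
      by (rule DERIV_unique)
    then show ?thesis
      unfolding u'_def by (simp add: algebra_simps)
  qed
  define W where "W A = ?L (u A)" for A
  have dW: "(W has_field_derivative - (2 * of_real pi * \<i> * u' A)) (at A)" if "A \<in> D" for A
    unfolding W_def using du[OF that] by (auto intro!: derivative_eq_intros)
  have WL: "W A \<in> ?L ` V" "W A \<noteq> 0" if "A \<in> D" for A
    unfolding W_def using u(1)[OF that] assms(10) by auto
  \<comment> \<open>The hypothesis on \<open>G (F1 A)\<close>, taken at \<open>u A\<close>, turns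
    the bracket into \<open>- G (y A)\<close>, and \<open>Gu\<close> evaluates the product.\<close>
  have ode: "(1 / W A - P0 (W A)) * (- (2 * of_real pi * \<i> * u' A)) = 2 * of_real pi * \<i>"
    if "A \<in> D" for A
  proof -
    have "1 / W A - P0 (W A) = - G (y A)"
      using assms(11)[OF u(1)[OF that]] u(2)[OF that] unfolding W_def by simp
    then show ?thesis using Gu[OF that] by simp
  qed
  \<comment> \<open>The affine map carries simple connectedness from \<open>V\<close> to its image,
    so \<open>P0\<close> has a primitive there.\<close>
  have "homeomorphism V (?L ` V) ?L (\<lambda>z. (c - z) / (2 * of_real pi * \<i>))"
    by (rule homeomorphismI) (auto intro!: continuous_intros)
  then have "simply_connected (?L ` V)"
    using assms(6) homeomorphic_def homeomorphic_simply_connected by blast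
  moreover have "open (?L ` V)"
    using assms(5) by (intro open_mapping_thm3) (auto intro!: holomorphic_intros simp: inj_on_def)
  ultimately have L: "open (?L ` V)" "simply_connected (?L ` V)"
    by blast+
  then obtain Q where Q: "\<And>t. t \<in> ?L ` V \<Longrightarrow> (Q has_field_derivative P0 t) (at t)"
    using assms(9) simply_connected_eq_global_primitive by metis
  \<comment> \<open>Any point of the image serves as base point; for empty \<open>D\<close> the
    value is irrelevant. Subtracting \<open>Q c'\<close> below makes the primitive the integral from
    \<open>c'\<close>.\<close>
  obtain c' where c': "D \<noteq> {} \<Longrightarrow> c' \<in> ?L ` V"
    using WL(1) by blast
  have dQ: "((\<lambda>z. Q z - Q c') has_field_derivative P0 (W A)) (at (W A))" if "A \<in> D" for A
    using Q[OF WL(1)[OF that]] by (auto intro!: derivative_eq_intros)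
  obtain C where C: "\<And>A. A \<in> D \<Longrightarrow> W A * exp (C - (Q (W A) - Q c')) = exp (2 * of_real pi * \<i> * A)"
    by (rule separable_ode_solution[OF assms(12,13) dW WL(2) dQ ode]) auto
  show ?thesis
  \<comment> \<open>The equation was solved once on all of \<open>D\<close>, so the same constants
    serve every \<open>D'\<close>; only the passage from \<open>A\<close> to \<open>q\<close> needs
    \<open>nome\<close> to be injective.\<close>
  proof (rule exI[of _ C], rule exI[of _ c'], intro allI impI, elim conjE)
    fix D' assume D': "open D'" "D' \<subseteq> D" "inj_on nome D'"
    have "nome holomorphic_on D'"
      unfolding nome_def by (intro holomorphic_intros)
    \<comment> \<open>\<open>n\<close> is a branch of the logarithm of \<open>q\<close> divided by
      \<open>2 \<pi> \<i>\<close>; composing \<open>W\<close> with it gives the required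
      \<open>w\<close>.\<close>
    then obtain n where n: "n holomorphic_on nome ` D'" "\<And>A. A \<in> D' \<Longrightarrow> n (nome A) = A"
      using holomorphic_has_inverse[OF _ D'(1,3)] by metis
    have "W holomorphic_on D'"
      using dW D'(1,2) by (meson holomorphic_on_open subsetD)
    then have Wn: "(W \<circ> n) holomorphic_on nome ` D'"
      using n by (intro holomorphic_on_compose_gen[where t = D']) auto
    have int: "has_region_integral (?L ` V) P0 c' (W A) (Q (W A) - Q c')" if "A \<in> D'" for A
      using that D'(2) c' WL(1) L simply_connected_imp_connected Q
      by (intro has_region_integral_exists[where g = Q]) auto
    have yF: "y A = F1 (- (W A / (2 * of_real pi * \<i>)) + c / (2 * of_real pi * \<i>))" if "A \<in> D'" for A
    proof -
      have "- (W A / (2 * of_real pi * \<i>)) + c / (2 * of_real pi * \<i>) = u A"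
        unfolding W_def by (simp add: field_simps)
      then show ?thesis using u(2) that D'(2) by auto
    qed
    have eq: "W A * exp (C - (Q (W A) - Q c')) = nome A" if "A \<in> D'" for A
      using C that D'(2) unfolding nome_def by blast
    show "\<exists>w. w holomorphic_on nome ` D' \<and>
                w ` nome ` D' \<subseteq> ?L ` V \<and>
                (\<forall>A\<in>D'. y A = F1 (- (w (nome A) / (2 * of_real pi * \<i>)) + c / (2 * of_real pi * \<i>))) \<and>
                (\<forall>q\<in>nome ` D'. \<exists>I. has_region_integral (?L ` V) P0 c' (w q) I \<and> w q * exp (C - I) = q)"
    proof (intro exI[of _ "W \<circ> n"] conjI ballI)
      show "(W \<circ> n) holomorphic_on nome ` D'"
        by (rule Wn)
      show "(W \<circ> n) ` nome ` D' \<subseteq> ?L ` V"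
        by (auto simp: n(2) simp del: image_iff intro!: WL(1) subsetD[OF D'(2)])
      show "y A = F1 (- ((W \<circ> n) (nome A) / (2 * of_real pi * \<i>)) + c / (2 * of_real pi * \<i>))"
        if "A \<in> D'" for A
        using yF[OF that] n(2)[OF that] by (simp only: comp_apply)
      show "\<exists>I. has_region_integral (?L ` V) P0 c' ((W \<circ> n) q) I \<and> (W \<circ> n) q * exp (C - I) = q"
        if q: "q \<in> nome ` D'" for q
      proof -
        obtain A where A: "A \<in> D'" "q = nome A"
          using q by blast
        then have "(W \<circ> n) q = W A"
          using n(2) by simp
        with int[OF A(1)] eq[OF A(1)] A(2) show ?thesis
          by (intro exI[of _ "Q (W A) - Q c'"]) (simp only: simp_thms)
      qed
    qed
  qed
qed

end
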